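(* Consider, for curves $t\mapsto X(t)$ in $\mathbb{R}^n$ with $U=\dot X$ and $A=\ddot X$, the fourth order system $$\frac{dC}{dt}=0,\qquad C=\frac{1}{|U|^2}\Big(\dot A-\frac{|A|^2}{|U|^2}U-2\frac{\langle A,U\rangle}{|U|^2}A+4\frac{\langle A,U\rangle^2}{|U|^4}U-2\frac{\langle\dot A,U\rangle}{|U|^2}U\Big).$$ Choosing arbitrary values of $X(0),U(0),A(0)$ and setting $C=0$ reduces this system to $$\dot A-\frac{2\langle A,U\rangle}{|U|^2}A+\frac{|A|^2}{|U|^2}U=0.$$ The general solution of this reduced system is $$t\mapsto X(t)=e^t\cos(ct)\,P_0+e^t\sin(ct)\,Q_0+R_0,$$ where $P_0,Q_0,R_0$ are constant vectors such that $\langle P_0,Q_0\rangle=0$ and $|P_0|=|Q_0|$. These curves are logarithmic spirals in the plane spanned by $(P_0,Q_0)$, which spiral towards $R_0$ as $t\to-\infty$. If $(r,\theta)$ are plane polar coordinates in the plane spanned by $P_0,Q_0$ and centred at $R_0$, then the unparametrised form of the spirals is $r=|P_0|e^{\theta/c}$.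
   Context: $\mathbb{R}^n$ carries a flat metric with vanishing Christoffel symbols, with inner product $\langle\cdot,\cdot\rangle$ and $|X|^2=\langle X,X\rangle$. Dots denote $d/dt$, and $c$ is a constant. The displayed fourth order system is the flat-space form of a conformally invariant fourth order system called the conformal Mercator equation; the vector $C$ is constant along its integral curves, and a solution is determined by specifying $X(0),U(0),A(0)$ and $C$. In the derivation of the general solution one writes $|U|=\dot h(t)$ and $H=\ddot h/\dot h$; when $C=0$ the function $H$ is a constant, and an affine transformation of $t$ is used to set $\dot h=e^t$.
   Formalization: Taken with n≥2, P₀≠0, and c≠0 for the spiral and polar claims; the general solution is for |U|=Ke^t, or for non-constant |U| up to affine change of t, since constant-speed solutions such as (cos t, sin t) solve the reduced system but are not of the stated form. *)

theory Defs
  imports "HOL-Analysis.Analysis"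
begin

definition velocity :: "(real \<Rightarrow> 'a::real_normed_vector) \<Rightarrow> real \<Rightarrow> 'a" where
  "velocity X t = vector_derivative X (at t)"

abbreviation acceleration :: "(real \<Rightarrow> 'a::real_normed_vector) \<Rightarrow> real \<Rightarrow> 'a" where
  "acceleration X \<equiv> velocity (velocity X)"

abbreviation jerk :: "(real \<Rightarrow> 'a::real_normed_vector) \<Rightarrow> real \<Rightarrow> 'a" where
  "jerk X \<equiv> velocity (velocity (velocity X))"

text \<open>The equations divide by \<open>|U|\<close>, so a solution is required to be regular (\<open>U \<noteq> 0\<close>)
  and as often differentiable as the order of the equation.\<close>

definition regular_curve :: "nat \<Rightarrow> real set \<Rightarrow> (real \<Rightarrow> 'a::real_normed_vector) \<Rightarrow> bool" where
  "regular_curve k I X \<longleftrightarrow>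
     (\<forall>j<k. \<forall>t\<in>I. (velocity ^^ j) X differentiable (at t)) \<and> (\<forall>t\<in>I. velocity X t \<noteq> 0)"

definition mercator_vector :: "(real \<Rightarrow> 'a::real_inner) \<Rightarrow> real \<Rightarrow> 'a" where
  "mercator_vector X t =
     (let U = velocity X t; A = acceleration X t; A' = jerk X t in
        (1 / (norm U)\<^sup>2) *\<^sub>R
          (A' - ((norm A)\<^sup>2 / (norm U)\<^sup>2) *\<^sub>R U
              - (2 * (A \<bullet> U) / (norm U)\<^sup>2) *\<^sub>R A
              + (4 * (A \<bullet> U)\<^sup>2 / (norm U) ^ 4) *\<^sub>R U
              - (2 * (A' \<bullet> U) / (norm U)\<^sup>2) *\<^sub>R U))"

definition solves_mercator :: "real set \<Rightarrow> (real \<Rightarrow> 'a::real_inner) \<Rightarrow> bool" where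
  "solves_mercator I X \<longleftrightarrow> regular_curve 4 I X \<and>
     (\<forall>t\<in>I. (mercator_vector X has_vector_derivative 0) (at t))"

definition solves_reduced :: "real set \<Rightarrow> (real \<Rightarrow> 'a::real_inner) \<Rightarrow> bool" where
  "solves_reduced I X \<longleftrightarrow> regular_curve 3 I X \<and>
     (\<forall>t\<in>I. let U = velocity X t; A = acceleration X t; A' = jerk X t in
        A' - (2 * (A \<bullet> U) / (norm U)\<^sup>2) *\<^sub>R A + ((norm A)\<^sup>2 / (norm U)\<^sup>2) *\<^sub>R U = 0)"

definition spiral_curve :: "real \<Rightarrow> 'a \<Rightarrow> 'a \<Rightarrow> 'a \<Rightarrow> real \<Rightarrow> 'a::real_vector" where
  "spiral_curve c P Q R t = (exp t * cos (c * t)) *\<^sub>R P + (exp t * sin (c * t)) *\<^sub>R Q + R"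

text \<open>\<open>P = 0\<close> would give a constant curve, on which the equations are undefined.\<close>

definition spiral_data :: "'a::real_inner \<Rightarrow> 'a \<Rightarrow> bool" where
  "spiral_data P Q \<longleftrightarrow> P \<noteq> 0 \<and> P \<bullet> Q = 0 \<and> norm P = norm Q"

definition polar_point :: "'a \<Rightarrow> 'a \<Rightarrow> 'a \<Rightarrow> real \<Rightarrow> real \<Rightarrow> 'a::real_vector" where
  "polar_point p e1 e2 r \<theta> = p + (r * cos \<theta>) *\<^sub>R e1 + (r * sin \<theta>) *\<^sub>R e2"

text \<open>A polar angle of a spiral ranges over all of the reals and is not taken modulo \<open>2\<pi>\<close>.
  Below \<open>V\<close> is the direction space of the plane \<open>p + V\<close> that contains the spiral.\<close>

definition logarithmic_spiral :: "'a::real_inner set \<Rightarrow> 'a \<Rightarrow> 'a set \<Rightarrow> bool" where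
  "logarithmic_spiral V p S \<longleftrightarrow>
     (\<exists>e1 e2 a k. norm e1 = 1 \<and> norm e2 = 1 \<and> e1 \<bullet> e2 = 0 \<and> span {e1, e2} = V \<and>
        a > 0 \<and> k \<noteq> 0 \<and> S = {polar_point p e1 e2 r \<theta> | r \<theta>. r = a * exp (k * \<theta>)})"

text \<open>The radius tends to \<open>0\<close> while a continuous polar angle winds around infinitely often.\<close>

definition spirals_towards ::
    "'a::real_inner set \<Rightarrow> 'a \<Rightarrow> (real \<Rightarrow> 'a) \<Rightarrow> real filter \<Rightarrow> bool" where
  "spirals_towards V p X F \<longleftrightarrow>
     (\<exists>e1 e2 r \<theta>. norm e1 = 1 \<and> norm e2 = 1 \<and> e1 \<bullet> e2 = 0 \<and> span {e1, e2} = V \<and>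
        continuous_on UNIV \<theta> \<and> (\<forall>t. r t > 0 \<and> X t = polar_point p e1 e2 (r t) (\<theta> t)) \<and>
        (r \<longlongrightarrow> 0) F \<and> filterlim (\<lambda>t. \<bar>\<theta> t\<bar>) at_top F)"

end

theory Submission
  imports Defs
begin

text \<open>
  Write \<open>R\<close> for the left-hand side of the reduced equation.  Up to the positive factor
  \<open>1 / |U|\<^sup>2\<close>, the vector \<open>C\<close> is the mirror image of \<open>R\<close> in the hyperplane orthogonal to \<open>U\<close>
  (\<open>mercator_vector_eq_reflection\<close>); a reflection is injective, so \<open>C = 0\<close> and \<open>R = 0\<close> are the
  same condition.  A solution of the reduced equation is automatically once more differentiable,
  because the equation itself writes \<open>A'\<close> as a differentiable expression in \<open>U\<close> and \<open>A\<close>.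

  The reduced equation is nonlinear only in appearance: along a solution the two coefficients
  \<open>\<langle>A, U\<rangle> / |U|\<^sup>2\<close> and \<open>|A|\<^sup>2 / |U|\<^sup>2\<close> are first integrals (\<open>reduced_invariants\<close>).
  By Cauchy-Schwarz they have the form \<open>\<alpha>\<close> and \<open>\<alpha>\<^sup>2 + \<beta>\<^sup>2\<close>, so the velocity satisfies
  \<open>U'' - 2 \<alpha> U' + (\<alpha>\<^sup>2 + \<beta>\<^sup>2) U = 0\<close>, whose characteristic roots are \<open>\<alpha> \<plusminus> i \<beta>\<close>.
  Hence \<open>U(t) = e\<^sup>\<alpha>\<^sup>t (cos(\<beta>t) u + sin(\<beta>t) w)\<close> with \<open>u\<close>, \<open>w\<close> orthogonal and of equal length
  (\<open>solves_reduced_imp_spiral_velocity\<close>).  Conversely each such velocity solves the equation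
  (\<open>solves_reduced_of_rotating_frame\<close>), and an orthogonal decomposition of \<open>A(0)\<close> along \<open>U(0)\<close>
  shows that every initial condition is met.

  The speed is \<open>e\<^sup>\<alpha>\<^sup>t |u|\<close>, so \<open>\<alpha> = 1\<close> is the normalisation \<open>|U| = K e\<^sup>t\<close>, and \<open>\<alpha> \<noteq> 0\<close> says that
  the speed is not constant.  When \<open>\<alpha> \<noteq> 0\<close> the velocity can be integrated within the plane of
  \<open>u\<close> and \<open>w\<close>, which is division by the complex number \<open>\<alpha> + i \<beta>\<close> and gives the spiral
  (\<open>spiral_curve_of_spiral_velocity\<close>).  In the orthonormal frame \<open>sgn P\<close>, \<open>sgn Q\<close> a spiral has the
  polar coordinates \<open>r = |P| e\<^sup>t\<close> and \<open>\<theta> = c t\<close>, from which its shape is read off.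
\<close>

section \<open>Derivatives along curves\<close>

lemma velocity_eqI:
  "(X has_vector_derivative u) (at t) \<Longrightarrow> velocity X t = u"
  by (simp add: velocity_def vector_derivative_at)

lemma has_vector_derivative_velocity:
  "X differentiable (at t) \<Longrightarrow> (X has_vector_derivative velocity X t) (at t)"
  by (simp add: velocity_def vector_derivative_works)

lemma has_vector_derivative_velocity_transform:
  assumes "open I" and "\<And>t. t \<in> I \<Longrightarrow> velocity X t = U t"
    and "t \<in> I" and "(U has_vector_derivative a) (at t)"
  shows "(velocity X has_vector_derivative a) (at t)"
  using has_vector_derivative_transform_within_open[OF assms(4,1,3)] assms(2) by simp

lemma regular_curve_mono:
  "regular_curve k I X \<Longrightarrow> l \<le> k \<Longrightarrow> regular_curve l I X"
  by (auto simp: regular_curve_def)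

lemma regular_curve_derivatives:
  assumes "regular_curve 3 I X" and "t \<in> I"
  shows "(X has_vector_derivative velocity X t) (at t)"
    and "(velocity X has_vector_derivative acceleration X t) (at t)"
    and "(acceleration X has_vector_derivative jerk X t) (at t)"
    and "velocity X t \<noteq> 0"
proof -
  have "(velocity ^^ j) X differentiable (at t)" if "j < 3" for j
    using assms that by (auto simp: regular_curve_def)
  from this[of 0] this[of 1] this[of 2] show "(X has_vector_derivative velocity X t) (at t)"
    and "(velocity X has_vector_derivative acceleration X t) (at t)"
    and "(acceleration X has_vector_derivative jerk X t) (at t)"
    by (simp_all add: has_vector_derivative_velocity numeral_2_eq_2)
  show "velocity X t \<noteq> 0"
    using assms by (auto simp: regular_curve_def)
qed

lemma zero_derivative_imp_eq:
  fixes f :: "real \<Rightarrow> 'a::real_normed_vector"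
  assumes "connected I" and "\<And>t. t \<in> I \<Longrightarrow> (f has_vector_derivative 0) (at t)"
    and "s \<in> I" and "t \<in> I"
  shows "f t = f s"
proof -
  have "convex I"
    using assms(1) is_interval_connected_1 is_interval_convex_1 by blast
  then obtain k where "\<And>x. x \<in> I \<Longrightarrow> f x = k"
    using has_vector_derivative_zero_constant[of I f] assms(2)
    by (metis has_vector_derivative_at_within)
  then show ?thesis
    using assms(3,4) by simp
qed

lemma has_vector_derivative_inner:
  assumes "(f has_vector_derivative f') (at t)" and "(g has_vector_derivative g') (at t)"
  shows "((\<lambda>t. f t \<bullet> g t) has_real_derivative f t \<bullet> g' + f' \<bullet> g t) (at t)"
  using bounded_bilinear.has_vector_derivative[OF bounded_bilinear_inner assms]
  by (simp add: has_real_derivative_iff_has_vector_derivative)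

section \<open>The Mercator vector and the reduced equation\<close>

definition reduced_vector :: "(real \<Rightarrow> 'a::real_inner) \<Rightarrow> real \<Rightarrow> 'a" where
  "reduced_vector X t =
     (let U = velocity X t; A = acceleration X t; A' = jerk X t in
        A' - (2 * (A \<bullet> U) / (norm U)\<^sup>2) *\<^sub>R A + ((norm A)\<^sup>2 / (norm U)\<^sup>2) *\<^sub>R U)"

lemma solves_reduced_iff:
  "solves_reduced I X \<longleftrightarrow> regular_curve 3 I X \<and> (\<forall>t\<in>I. reduced_vector X t = 0)"
  by (simp add: solves_reduced_def reduced_vector_def Let_def)

text \<open>The two expressions differ by a multiple of \<open>U\<close> only.  Since
  \<open>\<langle>R, U\<rangle> = \<langle>A', U\<rangle> - 2 \<langle>A, U\<rangle>\<^sup>2 / |U|\<^sup>2 + |A|\<^sup>2\<close> for the left-hand side \<open>R\<close> of the reduced equation,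
  this multiple is exactly the one of the reflection \<open>v \<mapsto> v - 2 \<langle>v, U\<rangle> U / |U|\<^sup>2\<close>.\<close>

lemma mercator_vector_eq_reflection:
  assumes "velocity X t \<noteq> 0"
  shows "mercator_vector X t =
    (1 / (norm (velocity X t))\<^sup>2) *\<^sub>R
      (reduced_vector X t
        - (2 * (reduced_vector X t \<bullet> velocity X t) / (norm (velocity X t))\<^sup>2) *\<^sub>R velocity X t)"
proof -
  define U where "U = velocity X t"
  define A where "A = acceleration X t"
  define J where "J = jerk X t"
  have "norm U ^ 4 = ((norm U)\<^sup>2)\<^sup>2"
    by simp
  then have n: "norm U ^ 4 = (U \<bullet> U)\<^sup>2" "(norm U)\<^sup>2 = U \<bullet> U" "(norm A)\<^sup>2 = A \<bullet> A"
    unfolding power2_norm_eq_inner by simp_all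
  have nz: "U \<bullet> U \<noteq> 0"
    using assms by (simp add: U_def)
  have R: "reduced_vector X t = J - (2 * (A \<bullet> U) / (U \<bullet> U)) *\<^sub>R A + ((A \<bullet> A) / (U \<bullet> U)) *\<^sub>R U"
    by (simp add: reduced_vector_def Let_def n(2,3)[unfolded U_def A_def] U_def A_def J_def)
  have M: "mercator_vector X t = (1 / (U \<bullet> U)) *\<^sub>R
     (J - ((A \<bullet> A) / (U \<bullet> U)) *\<^sub>R U - (2 * (A \<bullet> U) / (U \<bullet> U)) *\<^sub>R A
       + (4 * (A \<bullet> U)\<^sup>2 / (U \<bullet> U)\<^sup>2) *\<^sub>R U - (2 * (J \<bullet> U) / (U \<bullet> U)) *\<^sub>R U)"
    by (simp add: mercator_vector_def Let_def n[unfolded U_def A_def] U_def A_def J_def)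
  define r where "r = reduced_vector X t \<bullet> U"
  have r: "r = J \<bullet> U - 2 * (A \<bullet> U)\<^sup>2 / (U \<bullet> U) + A \<bullet> A"
    using nz by (simp add: r_def R inner_simps power2_eq_square)
  have coeff: "2 * r / (U \<bullet> U) = 2 * (J \<bullet> U) / (U \<bullet> U) - 4 * (A \<bullet> U)\<^sup>2 / (U \<bullet> U)\<^sup>2
      + ((A \<bullet> A) / (U \<bullet> U) + (A \<bullet> A) / (U \<bullet> U))"
    unfolding r using nz by (simp add: field_simps power2_eq_square)
  have "reduced_vector X t - (2 * r / (U \<bullet> U)) *\<^sub>R U =
     J - ((A \<bullet> A) / (U \<bullet> U)) *\<^sub>R U - (2 * (A \<bullet> U) / (U \<bullet> U)) *\<^sub>R A
       + (4 * (A \<bullet> U)\<^sup>2 / (U \<bullet> U)\<^sup>2) *\<^sub>R U - (2 * (J \<bullet> U) / (U \<bullet> U)) *\<^sub>R U"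
    unfolding coeff R scaleR_add_left scaleR_diff_left by simp
  then show ?thesis
    unfolding M r_def n(2)[unfolded U_def] U_def by simp
qed

text \<open>Pairing with \<open>U\<close> shows that the reflection only changes the sign of the component along \<open>U\<close>,
  so nothing is lost.\<close>

lemma mercator_vector_eq_0_iff:
  assumes U: "velocity X t \<noteq> 0"
  shows "mercator_vector X t = 0 \<longleftrightarrow> reduced_vector X t = 0"
proof
  define U R where "U = velocity X t" and "R = reduced_vector X t"
  assume "mercator_vector X t = 0"
  then have *: "R = (2 * (R \<bullet> U) / (norm U)\<^sup>2) *\<^sub>R U"
    using U by (simp add: mercator_vector_eq_reflection U_def R_def)
  have "R \<bullet> U = (2 * (R \<bullet> U) / (norm U)\<^sup>2) * (U \<bullet> U)"
    using arg_cong[OF *, of "\<lambda>v. v \<bullet> U"] by simp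
  then have "R \<bullet> U = 0"
    using U by (simp add: power2_norm_eq_inner U_def)
  then show "reduced_vector X t = 0"
    using * by (simp add: R_def)
next
  assume "reduced_vector X t = 0"
  then show "mercator_vector X t = 0"
    using U by (simp add: mercator_vector_eq_reflection)
qed

text \<open>The backward direction has to supply a fourth derivative of \<open>X\<close>: the reduced equation
  writes \<open>A'\<close> on the open set \<open>I\<close> as a rational expression in the differentiable \<open>U\<close> and \<open>A\<close>.\<close>

lemma solves_mercator_zero_iff_solves_reduced:
  fixes X :: "real \<Rightarrow> 'a::real_inner"
  assumes I: "open I" "connected I" "0 \<in> I"
  shows "solves_mercator I X \<and> mercator_vector X 0 = 0 \<longleftrightarrow> solves_reduced I X"
proof
  assume *: "solves_mercator I X \<and> mercator_vector X 0 = 0"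
  then have reg: "regular_curve 4 I X"
    and d: "\<And>t. t \<in> I \<Longrightarrow> (mercator_vector X has_vector_derivative 0) (at t)"
    by (auto simp: solves_mercator_def)
  have "mercator_vector X t = 0" if "t \<in> I" for t
    using zero_derivative_imp_eq[OF I(2) d I(3) that] * by simp
  then show "solves_reduced I X"
    using reg regular_curve_mono[OF reg, of 3]
    by (auto simp: solves_reduced_iff regular_curve_def mercator_vector_eq_0_iff)
next
  assume *: "solves_reduced I X"
  then have reg: "regular_curve 3 I X" and red: "\<And>t. t \<in> I \<Longrightarrow> reduced_vector X t = 0"
    by (auto simp: solves_reduced_iff)
  have zero: "mercator_vector X t = 0" if "t \<in> I" for t
    using red[OF that] regular_curve_derivatives(4)[OF reg that] by (simp add: mercator_vector_eq_0_iff)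
  define U A where "U = velocity X" and "A = velocity U"
  have jerk: "velocity A t = (2 * (A t \<bullet> U t) / (U t \<bullet> U t)) *\<^sub>R A t - ((A t \<bullet> A t) / (U t \<bullet> U t)) *\<^sub>R U t"
    if "t \<in> I" for t
    using red[OF that]
    by (simp add: reduced_vector_def Let_def U_def A_def power2_norm_eq_inner algebra_simps
        eq_neg_iff_add_eq_0)
  have "jerk X differentiable (at t)" if t: "t \<in> I" for t
  proof -
    note d = regular_curve_derivatives[OF reg t, folded U_def, folded A_def]
    have n: "U t \<bullet> U t \<noteq> 0"
      using d(4) by simp
    have "U differentiable (at t)" "A differentiable (at t)"
      using d(2,3) by (auto intro: differentiableI_vector)
    then have "(\<lambda>t. (2 * (A t \<bullet> U t) / (U t \<bullet> U t)) *\<^sub>R A t - ((A t \<bullet> A t) / (U t \<bullet> U t)) *\<^sub>R U t)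
        differentiable (at t)"
      using n by (intro differentiable_diff differentiable_scaleR differentiable_divide
          differentiable_mult differentiable_inner differentiable_const)
    then have "\<exists>v. ((\<lambda>t. (2 * (A t \<bullet> U t) / (U t \<bullet> U t)) *\<^sub>R A t - ((A t \<bullet> A t) / (U t \<bullet> U t)) *\<^sub>R U t)
        has_vector_derivative v) (at t)"
      by (auto simp: vector_derivative_works)
    then obtain v where "(velocity A has_vector_derivative v) (at t)"
      using has_vector_derivative_velocity_transform[OF I(1) jerk t] by blast
    then show ?thesis
      unfolding A_def U_def by (rule differentiableI_vector)
  qed
  moreover have "(\<forall>j<4. P j) \<longleftrightarrow> (\<forall>j<3. P j) \<and> P 3" for P :: "nat \<Rightarrow> bool"
    by (auto simp: less_Suc_eq numeral_eq_Suc)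
  ultimately have "regular_curve 4 I X"
    using reg by (auto simp: regular_curve_def numeral_3_eq_3)
  moreover have "(mercator_vector X has_vector_derivative 0) (at t)" if "t \<in> I" for t
    using has_vector_derivative_transform_within_open[OF has_vector_derivative_const I(1) that,
        of 0 "mercator_vector X"] zero by simp
  ultimately show "solves_mercator I X \<and> mercator_vector X 0 = 0"
    using zero I(3) by (simp add: solves_mercator_def)
qed

section \<open>Rotating frames solve the reduced equation\<close>

text \<open>The frame \<open>(U, W)\<close> is scaled at the rate \<open>\<alpha>\<close> and turned at the rate \<open>\<beta>\<close>: with
  \<open>i\<close> acting on its plane by \<open>i U = W\<close> and \<open>i W = - U\<close>, differentiation is multiplication by
  \<open>z = \<alpha> + i \<beta>\<close>, and the reduced equation becomes \<open>z\<^sup>2 - 2 \<alpha> z + |z|\<^sup>2 = 0\<close>.  Working with the frame and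
  not with explicit formulas serves velocities and reparametrised spirals alike.\<close>

lemma solves_reduced_of_rotating_frame:
  fixes X U W :: "real \<Rightarrow> 'a::real_inner"
  assumes "open I"
    and dX: "\<And>t. t \<in> I \<Longrightarrow> (X has_vector_derivative U t) (at t)"
    and dU: "\<And>t. t \<in> I \<Longrightarrow> (U has_vector_derivative \<alpha> *\<^sub>R U t + \<beta> *\<^sub>R W t) (at t)"
    and dW: "\<And>t. t \<in> I \<Longrightarrow> (W has_vector_derivative \<alpha> *\<^sub>R W t - \<beta> *\<^sub>R U t) (at t)"
    and frame: "\<And>t. t \<in> I \<Longrightarrow> spiral_data (U t) (W t)"
  shows "solves_reduced I X"
proof -
  have U: "velocity X t = U t" if "t \<in> I" for t
    using dX[OF that] by (rule velocity_eqI)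
  have dU': "(velocity X has_vector_derivative \<alpha> *\<^sub>R U t + \<beta> *\<^sub>R W t) (at t)" if "t \<in> I" for t
    using has_vector_derivative_velocity_transform[OF assms(1) U that dU[OF that]] .
  have A: "acceleration X t = \<alpha> *\<^sub>R U t + \<beta> *\<^sub>R W t" if "t \<in> I" for t
    using dU'[OF that] by (rule velocity_eqI)
  have "((\<lambda>t. \<alpha> *\<^sub>R U t + \<beta> *\<^sub>R W t) has_vector_derivative
      \<alpha> *\<^sub>R (\<alpha> *\<^sub>R U t + \<beta> *\<^sub>R W t) + \<beta> *\<^sub>R (\<alpha> *\<^sub>R W t - \<beta> *\<^sub>R U t)) (at t)" if "t \<in> I" for t
    by (auto intro!: derivative_eq_intros dU dW that)
  from has_vector_derivative_velocity_transform[OF assms(1) A _ this]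
  have dA: "(acceleration X has_vector_derivative
      \<alpha> *\<^sub>R (\<alpha> *\<^sub>R U t + \<beta> *\<^sub>R W t) + \<beta> *\<^sub>R (\<alpha> *\<^sub>R W t - \<beta> *\<^sub>R U t)) (at t)" if "t \<in> I" for t
    using that by blast
  have "regular_curve 3 I X"
    using dX dU' dA frame U
    by (auto simp: regular_curve_def less_Suc_eq numeral_3_eq_3 spiral_data_def
        intro: differentiableI_vector)
  moreover have "reduced_vector X t = 0" if t: "t \<in> I" for t
  proof -
    define n where "n = U t \<bullet> U t"
    have n: "n \<noteq> 0" "U t \<bullet> W t = 0" "W t \<bullet> U t = 0" "U t \<bullet> U t = n" "W t \<bullet> W t = n"
      using frame[OF t] by (auto simp: n_def spiral_data_def inner_commute norm_eq)
    have J: "jerk X t = \<alpha> *\<^sub>R (\<alpha> *\<^sub>R U t + \<beta> *\<^sub>R W t) + \<beta> *\<^sub>R (\<alpha> *\<^sub>R W t - \<beta> *\<^sub>R U t)"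
      using dA[OF t] by (rule velocity_eqI)
    have 1: "2 * ((\<alpha> *\<^sub>R U t + \<beta> *\<^sub>R W t) \<bullet> U t) / (U t \<bullet> U t) = 2 * \<alpha>"
      using n by (simp add: inner_simps)
    have 2: "((\<alpha> *\<^sub>R U t + \<beta> *\<^sub>R W t) \<bullet> (\<alpha> *\<^sub>R U t + \<beta> *\<^sub>R W t)) / (U t \<bullet> U t) = \<alpha>\<^sup>2 + \<beta>\<^sup>2"
      using n by (simp add: inner_simps field_simps power2_eq_square)
    have two: "(2 * \<alpha>) *\<^sub>R v = \<alpha> *\<^sub>R v + \<alpha> *\<^sub>R v" for v :: 'a
      by (metis mult_2 scaleR_add_left)
    show ?thesis
      unfolding reduced_vector_def Let_def power2_norm_eq_inner U[OF t] A[OF t] J 1 2 two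
      by (simp add: algebra_simps power2_eq_square)
  qed
  ultimately show ?thesis
    by (simp add: solves_reduced_iff)
qed

text \<open>If \<open>P\<close>, \<open>Q\<close> are identified with \<open>1\<close>, \<open>i\<close>, the two new vectors are \<open>x + i y\<close> and
  \<open>i (x + i y)\<close>: multiplication by a complex number scales and rotates.\<close>

lemma spiral_data_complex_multiple:
  fixes P Q :: "'a::real_inner"
  assumes "spiral_data P Q" and "(x, y) \<noteq> (0, 0)"
  shows "norm (x *\<^sub>R P + y *\<^sub>R Q) = sqrt (x\<^sup>2 + y\<^sup>2) * norm P"
    and "spiral_data (x *\<^sub>R P + y *\<^sub>R Q) (x *\<^sub>R Q - y *\<^sub>R P)"
proof -
  define n where "n = P \<bullet> P"
  have n: "n > 0" "P \<bullet> Q = 0" "Q \<bullet> P = 0" "P \<bullet> P = n" "Q \<bullet> Q = n"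
    using assms(1) by (auto simp: n_def spiral_data_def inner_commute norm_eq)
  have 1: "(x *\<^sub>R P + y *\<^sub>R Q) \<bullet> (x *\<^sub>R P + y *\<^sub>R Q) = (x\<^sup>2 + y\<^sup>2) * n"
    "(x *\<^sub>R Q - y *\<^sub>R P) \<bullet> (x *\<^sub>R Q - y *\<^sub>R P) = (x\<^sup>2 + y\<^sup>2) * n"
    "(x *\<^sub>R P + y *\<^sub>R Q) \<bullet> (x *\<^sub>R Q - y *\<^sub>R P) = 0"
    using n by (simp_all add: inner_simps algebra_simps power2_eq_square)
  show "norm (x *\<^sub>R P + y *\<^sub>R Q) = sqrt (x\<^sup>2 + y\<^sup>2) * norm P"
    by (simp add: norm_eq_sqrt_inner 1 n real_sqrt_mult)
  have "x\<^sup>2 + y\<^sup>2 > 0"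
    using assms(2) by (auto simp: sum_power2_gt_zero_iff)
  then have "(x\<^sup>2 + y\<^sup>2) * n > 0"
    using n(1) by (rule mult_pos_pos)
  then have "x *\<^sub>R P + y *\<^sub>R Q \<noteq> 0"
    using 1(1) by force
  then show "spiral_data (x *\<^sub>R P + y *\<^sub>R Q) (x *\<^sub>R Q - y *\<^sub>R P)"
    using 1 by (auto simp: spiral_data_def norm_eq)
qed

text \<open>Unlike \<open>spiral_curve\<close>, this family includes \<open>\<alpha> = 0\<close>, which is needed for the solutions
  of constant speed (lines and circles).\<close>

definition spiral_velocity :: "real \<Rightarrow> real \<Rightarrow> 'a \<Rightarrow> 'a \<Rightarrow> real \<Rightarrow> 'a::real_vector" where
  "spiral_velocity \<alpha> \<beta> u w t = (exp (\<alpha> * t) * cos (\<beta> * t)) *\<^sub>R u + (exp (\<alpha> * t) * sin (\<beta> * t)) *\<^sub>R w"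

lemma has_vector_derivative_spiral_velocity:
  "(spiral_velocity \<alpha> \<beta> u w has_vector_derivative
      \<alpha> *\<^sub>R spiral_velocity \<alpha> \<beta> u w t + \<beta> *\<^sub>R spiral_velocity \<alpha> \<beta> w (- u) t) (at t)"
  unfolding spiral_velocity_def[abs_def]
  by (auto intro!: derivative_eq_intros has_vector_derivative_scaleR simp: algebra_simps)

lemma spiral_velocity_minus:
  "spiral_velocity \<alpha> \<beta> (- u) (- w) t = - spiral_velocity \<alpha> \<beta> u w t"
  by (simp add: spiral_velocity_def)

lemma norm_spiral_velocity:
  assumes "spiral_data u w"
  shows "norm (spiral_velocity \<alpha> \<beta> u w t) = exp (\<alpha> * t) * norm u"
proof -
  have "(exp (\<alpha> * t) * cos (\<beta> * t))\<^sup>2 + (exp (\<alpha> * t) * sin (\<beta> * t))\<^sup>2 = (exp (\<alpha> * t))\<^sup>2"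
    by (simp add: power_mult_distrib flip: distrib_left)
  moreover have "(exp (\<alpha> * t) * cos (\<beta> * t), exp (\<alpha> * t) * sin (\<beta> * t)) \<noteq> (0, 0)"
    using sin_zero_abs_cos_one by fastforce
  ultimately show ?thesis
    using spiral_data_complex_multiple(1)[OF assms] by (simp add: spiral_velocity_def)
qed

lemma spiral_data_spiral_velocity:
  assumes "spiral_data u w"
  shows "spiral_data (spiral_velocity \<alpha> \<beta> u w t) (spiral_velocity \<alpha> \<beta> w (- u) t)"
proof -
  have "(exp (\<alpha> * t) * cos (\<beta> * t), exp (\<alpha> * t) * sin (\<beta> * t)) \<noteq> (0, 0)"
    using sin_zero_abs_cos_one by fastforce
  from spiral_data_complex_multiple(2)[OF assms this] show ?thesis
    by (simp add: spiral_velocity_def)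
qed

lemma solves_reduced_of_spiral_velocity:
  assumes "open I" and "spiral_data u w"
    and "\<And>t. t \<in> I \<Longrightarrow> (X has_vector_derivative spiral_velocity \<alpha> \<beta> u w t) (at t)"
  shows "solves_reduced I X"
proof (rule solves_reduced_of_rotating_frame[where \<alpha> = \<alpha> and \<beta> = \<beta>])
  show "(spiral_velocity \<alpha> \<beta> w (- u) has_vector_derivative
      \<alpha> *\<^sub>R spiral_velocity \<alpha> \<beta> w (- u) t - \<beta> *\<^sub>R spiral_velocity \<alpha> \<beta> u w t) (at t)" for t
    using has_vector_derivative_spiral_velocity[of \<alpha> \<beta> w "- u" t]
    by (simp add: spiral_velocity_minus)
qed (use assms has_vector_derivative_spiral_velocity spiral_data_spiral_velocity in auto)

section \<open>Initial data\<close>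

lemma exists_spiral_data:
  fixes u :: "'a::euclidean_space"
  assumes "2 \<le> DIM('a)" and "u \<noteq> 0"
  obtains w where "spiral_data u w"
proof -
  obtain y where y: "y \<noteq> 0" "orthogonal u y"
    using orthogonal_to_vector_exists[OF assms(1)] .
  then have "spiral_data u ((norm u / norm y) *\<^sub>R y)"
    using assms(2) by (simp add: spiral_data_def orthogonal_def)
  then show ?thesis by (rule that)
qed

text \<open>When \<open>a\<close> is parallel to \<open>u\<close> there is no distinguished normal direction and \<open>\<beta> = 0\<close>; a
  vector \<open>w\<close> still exists because the dimension is at least 2.\<close>

lemma exists_frame_decomposition:
  fixes u a :: "'a::euclidean_space"
  assumes "2 \<le> DIM('a)" and "u \<noteq> 0"
  obtains \<alpha> \<beta> w where "spiral_data u w" and "a = \<alpha> *\<^sub>R u + \<beta> *\<^sub>R w"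
proof -
  define \<alpha> where "\<alpha> = (a \<bullet> u) / (u \<bullet> u)"
  define b where "b = a - \<alpha> *\<^sub>R u"
  have b: "u \<bullet> b = 0"
    using assms(2) by (simp add: b_def \<alpha>_def inner_simps inner_commute)
  show ?thesis
  proof (cases "b = 0")
    case True
    obtain w where "spiral_data u w"
      using exists_spiral_data[OF assms] .
    moreover have "a = \<alpha> *\<^sub>R u + 0 *\<^sub>R w"
      using True by (simp add: b_def)
    ultimately show ?thesis by (rule that)
  next
    case False
    have "spiral_data u ((norm u / norm b) *\<^sub>R b)"
      using False assms(2) b by (simp add: spiral_data_def)
    moreover have "a = \<alpha> *\<^sub>R u + (norm b / norm u) *\<^sub>R ((norm u / norm b) *\<^sub>R b)"
      using False assms(2) by (simp add: b_def)
    ultimately show ?thesis by (rule that)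
  qed
qed

text \<open>The decomposition of \<open>a\<close> determines the velocity for all times.  An abstract
  antiderivative of it avoids distinguishing whether \<open>\<alpha> + i \<beta>\<close> vanishes.\<close>

lemma exists_reduced_solution:
  fixes x u a :: "'a::euclidean_space"
  assumes "2 \<le> DIM('a)" and "u \<noteq> 0"
  obtains Y where "solves_reduced UNIV Y" and "Y 0 = x" and "velocity Y 0 = u"
    and "acceleration Y 0 = a"
proof -
  obtain \<alpha> \<beta> w where w: "spiral_data u w" and a: "a = \<alpha> *\<^sub>R u + \<beta> *\<^sub>R w"
    using exists_frame_decomposition[OF assms] .
  let ?V = "spiral_velocity \<alpha> \<beta> u w"
  have "isCont ?V t" for t
    using has_vector_derivative_spiral_velocity has_vector_derivative_continuous by blast
  then obtain Z where Z: "(Z has_vector_derivative ?V t) (at t)" for t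
    using einterval_antiderivative[of "- \<infinity>" \<infinity> ?V] by auto
  define Y where "Y t = Z t + (x - Z 0)" for t
  have dY: "(Y has_vector_derivative ?V t) (at t)" for t
    unfolding Y_def[abs_def] by (auto intro!: derivative_eq_intros Z)
  have V: "velocity Y = ?V"
    using dY by (auto intro: velocity_eqI)
  show ?thesis
  proof
    show "solves_reduced UNIV Y"
      using solves_reduced_of_spiral_velocity[OF open_UNIV w dY] .
    show "Y 0 = x"
      by (simp add: Y_def)
    show "velocity Y 0 = u"
      by (simp add: V spiral_velocity_def)
    show "acceleration Y 0 = a"
      unfolding V a by (rule velocity_eqI)
        (use has_vector_derivative_spiral_velocity[of \<alpha> \<beta> u w 0] in \<open>simp add: spiral_velocity_def\<close>)
  qed
qed

section \<open>Integration of the reduced equation\<close>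

text \<open>Put \<open>f = \<langle>A, U\<rangle> / |U|\<^sup>2\<close> and \<open>g = |A|\<^sup>2 / |U|\<^sup>2\<close>, so that the equation reads
  \<open>A' = 2 f A - g U\<close>.  Then \<open>\<langle>A', U\<rangle> / |U|\<^sup>2 = 2 f\<^sup>2 - g\<close> and \<open>\<langle>A', A\<rangle> / |U|\<^sup>2 = f g\<close>, hence
  \<open>f' = (2 f\<^sup>2 - g) + g - 2 f\<^sup>2 = 0\<close> and \<open>g' = 2 f g - 2 f g = 0\<close>.\<close>

lemma reduced_invariants:
  fixes X :: "real \<Rightarrow> 'a::real_inner"
  assumes "connected I" and "solves_reduced I X" and "s \<in> I" and "t \<in> I"
  shows "(acceleration X t \<bullet> velocity X t) / (velocity X t \<bullet> velocity X t) =
      (acceleration X s \<bullet> velocity X s) / (velocity X s \<bullet> velocity X s)" (is "?f t = ?f s")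
    and "(acceleration X t \<bullet> acceleration X t) / (velocity X t \<bullet> velocity X t) =
      (acceleration X s \<bullet> acceleration X s) / (velocity X s \<bullet> velocity X s)" (is "?g t = ?g s")
proof -
  define U A J where "U = velocity X" and "A = velocity U" and "J = velocity A"
  have reg: "regular_curve 3 I X"
    using assms(2) by (simp add: solves_reduced_iff)
  note d = regular_curve_derivatives[OF reg, folded U_def, folded A_def, folded J_def]
  have J: "J t = (2 * ?f t) *\<^sub>R A t - ?g t *\<^sub>R U t" if "t \<in> I" for t
    using assms(2) that
    by (auto simp: solves_reduced_iff reduced_vector_def Let_def U_def A_def J_def
        power2_norm_eq_inner algebra_simps eq_neg_iff_add_eq_0)
  have df: "(?f has_vector_derivative 0) (at t)" if t: "t \<in> I" for t
  proof -
    have n: "U t \<bullet> U t \<noteq> 0"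
      using d(4)[OF t] by simp
    have "(?f has_real_derivative
       ((A t \<bullet> A t + J t \<bullet> U t) * (U t \<bullet> U t) - (A t \<bullet> U t) * (U t \<bullet> A t + A t \<bullet> U t))
         / ((U t \<bullet> U t) * (U t \<bullet> U t))) (at t)"
      unfolding U_def[symmetric] A_def[symmetric]
      by (intro DERIV_divide has_vector_derivative_inner d t n)
    moreover have "(A t \<bullet> A t + J t \<bullet> U t) * (U t \<bullet> U t) - (A t \<bullet> U t) * (U t \<bullet> A t + A t \<bullet> U t) = 0"
      using n unfolding J[OF t] U_def[symmetric] A_def[symmetric]
      by (simp add: inner_simps inner_commute field_simps)
    ultimately show ?thesis
      by (simp add: has_real_derivative_iff_has_vector_derivative)
  qed
  have dg: "(?g has_vector_derivative 0) (at t)" if t: "t \<in> I" for t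
  proof -
    have n: "U t \<bullet> U t \<noteq> 0"
      using d(4)[OF t] by simp
    have "(?g has_real_derivative
       ((A t \<bullet> J t + J t \<bullet> A t) * (U t \<bullet> U t) - (A t \<bullet> A t) * (U t \<bullet> A t + A t \<bullet> U t))
         / ((U t \<bullet> U t) * (U t \<bullet> U t))) (at t)"
      unfolding U_def[symmetric] A_def[symmetric]
      by (intro DERIV_divide has_vector_derivative_inner d t n)
    moreover have "(A t \<bullet> J t + J t \<bullet> A t) * (U t \<bullet> U t) - (A t \<bullet> A t) * (U t \<bullet> A t + A t \<bullet> U t) = 0"
      using n unfolding J[OF t] U_def[symmetric] A_def[symmetric]
      by (simp add: inner_simps inner_commute field_simps)
    ultimately show ?thesis
      by (simp add: has_real_derivative_iff_has_vector_derivative)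
  qed
  show "?f t = ?f s" "?g t = ?g s"
    using zero_derivative_imp_eq[OF assms(1) df assms(3,4)]
      zero_derivative_imp_eq[OF assms(1) dg assms(3,4)] by simp_all
qed

text \<open>Rotating \<open>(\<beta> U, B)\<close> back by the angle \<open>\<beta> t\<close> and rescaling by \<open>e\<^sup>-\<^sup>\<alpha>\<^sup>t\<close> gives two
  constants of motion \<open>E\<close> and \<open>F\<close>, which determine \<open>\<beta> U\<close>.  For \<open>\<beta> = 0\<close> they carry no information
  on \<open>U\<close>, but then \<open>B\<close> vanishes and \<open>U' = \<alpha> U\<close>.\<close>

lemma linear_system_unique:
  fixes U B :: "real \<Rightarrow> 'a::real_normed_vector"
  assumes I: "connected I" "0 \<in> I" "t \<in> I"
    and dU: "\<And>t. t \<in> I \<Longrightarrow> (U has_vector_derivative \<alpha> *\<^sub>R U t + B t) (at t)"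
    and dB: "\<And>t. t \<in> I \<Longrightarrow> (B has_vector_derivative \<alpha> *\<^sub>R B t - \<beta>\<^sup>2 *\<^sub>R U t) (at t)"
    and init: "B 0 = \<beta> *\<^sub>R w"
  shows "U t = spiral_velocity \<alpha> \<beta> (U 0) w t"
proof -
  define E F where
    "E t = exp (- \<alpha> * t) *\<^sub>R ((\<beta> * cos (\<beta> * t)) *\<^sub>R U t - sin (\<beta> * t) *\<^sub>R B t)" and
    "F t = exp (- \<alpha> * t) *\<^sub>R ((\<beta> * sin (\<beta> * t)) *\<^sub>R U t + cos (\<beta> * t) *\<^sub>R B t)" for t
  have "(E has_vector_derivative 0) (at t)" if "t \<in> I" for t
    unfolding E_def[abs_def]
    by (rule has_vector_derivative_eq_rhs,
        (rule has_vector_derivative_scaleR has_vector_derivative_diff dU[OF that] dB[OF that]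
          derivative_intros)+)
      (simp add: algebra_simps power2_eq_square)
  from zero_derivative_imp_eq[OF I(1) this I(2,3)]
  have E: "E t = \<beta> *\<^sub>R U 0"
    by (simp add: E_def)
  have "(F has_vector_derivative 0) (at t)" if "t \<in> I" for t
    unfolding F_def[abs_def]
    by (rule has_vector_derivative_eq_rhs,
        (rule has_vector_derivative_scaleR has_vector_derivative_add dU[OF that] dB[OF that]
          derivative_intros)+)
      (simp add: algebra_simps power2_eq_square)
  from zero_derivative_imp_eq[OF I(1) this I(2)]
  have F: "F t = \<beta> *\<^sub>R w" if "t \<in> I" for t
    using that by (simp add: F_def init)
  show ?thesis
  proof (cases "\<beta> = 0")
    case True
    then have "B t = 0" if "t \<in> I" for t
      using F[OF that] by (simp add: F_def)
    then have "(U has_vector_derivative \<alpha> *\<^sub>R U t) (at t)" if "t \<in> I" for t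
      using dU[OF that] that by simp
    then have "((\<lambda>t. exp (- \<alpha> * t) *\<^sub>R U t) has_vector_derivative 0) (at t)" if "t \<in> I" for t
      using that by (auto intro!: derivative_eq_intros has_vector_derivative_scaleR)
    from zero_derivative_imp_eq[OF I(1) this I(2,3)]
    have "exp (\<alpha> * t) *\<^sub>R exp (- \<alpha> * t) *\<^sub>R U t = exp (\<alpha> * t) *\<^sub>R U 0"
      by simp
    then show ?thesis
      using True by (simp add: spiral_velocity_def flip: exp_add)
  next
    case False
    have rot: "x *\<^sub>R e *\<^sub>R ((\<beta> * x) *\<^sub>R U t - y *\<^sub>R B t) + y *\<^sub>R e *\<^sub>R ((\<beta> * y) *\<^sub>R U t + x *\<^sub>R B t) =
        (e * \<beta> * (x\<^sup>2 + y\<^sup>2)) *\<^sub>R U t" for e x y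
      by (simp add: algebra_simps power2_eq_square)
    have comb: "cos (\<beta> * t) *\<^sub>R E t + sin (\<beta> * t) *\<^sub>R F t = (exp (- \<alpha> * t) * \<beta>) *\<^sub>R U t"
      unfolding E_def F_def rot by simp
    have "exp (\<alpha> * t) *\<^sub>R (cos (\<beta> * t) *\<^sub>R E t + sin (\<beta> * t) *\<^sub>R F t) = \<beta> *\<^sub>R U t"
      unfolding comb by (simp add: exp_minus)
    moreover have "\<beta> *\<^sub>R spiral_velocity \<alpha> \<beta> (U 0) w t =
        exp (\<alpha> * t) *\<^sub>R (cos (\<beta> * t) *\<^sub>R E t + sin (\<beta> * t) *\<^sub>R F t)"
      by (simp add: E F[OF I(3)] spiral_velocity_def algebra_simps)
    ultimately show ?thesis
      using False by simp
  qed
qed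

text \<open>The component \<open>B = A - \<alpha> U\<close> of the acceleration normal to the curve closes the equations to
  the first order system \<open>U' = \<alpha> U + B\<close>, \<open>B' = \<alpha> B - \<beta>\<^sup>2 U\<close> with constant coefficients.\<close>

lemma solves_reduced_imp_spiral_velocity:
  fixes X :: "real \<Rightarrow> 'a::euclidean_space"
  assumes dim: "2 \<le> DIM('a)" and I: "connected I" "0 \<in> I" and sol: "solves_reduced I X"
  obtains \<alpha> \<beta> u w where "spiral_data u w"
    and "\<And>t. t \<in> I \<Longrightarrow> (X has_vector_derivative spiral_velocity \<alpha> \<beta> u w t) (at t)"
proof -
  define U A where "U = velocity X" and "A = velocity U"
  have reg: "regular_curve 3 I X"
    using sol by (simp add: solves_reduced_iff)
  note d = regular_curve_derivatives[OF reg, folded U_def, folded A_def]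
  obtain \<alpha> \<beta> w where w: "spiral_data (U 0) w" and a: "A 0 = \<alpha> *\<^sub>R U 0 + \<beta> *\<^sub>R w"
    using exists_frame_decomposition[OF dim d(4)[OF I(2)]] .
  define n where "n = U 0 \<bullet> U 0"
  have n: "n \<noteq> 0" "U 0 \<bullet> w = 0" "w \<bullet> U 0 = 0" "U 0 \<bullet> U 0 = n" "w \<bullet> w = n"
    using w by (auto simp: n_def spiral_data_def inner_commute norm_eq)
  have "(A 0 \<bullet> U 0) / (U 0 \<bullet> U 0) = \<alpha>" "(A 0 \<bullet> A 0) / (U 0 \<bullet> U 0) = \<alpha>\<^sup>2 + \<beta>\<^sup>2"
    using n by (simp_all add: a inner_simps field_simps power2_eq_square)
  then have inv: "(A t \<bullet> U t) / (U t \<bullet> U t) = \<alpha>" "(A t \<bullet> A t) / (U t \<bullet> U t) = \<alpha>\<^sup>2 + \<beta>\<^sup>2"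
    if "t \<in> I" for t
    using reduced_invariants[OF I(1) sol I(2) that] by (simp_all add: U_def A_def)
  have J: "velocity A t = (2 * \<alpha>) *\<^sub>R A t - (\<alpha>\<^sup>2 + \<beta>\<^sup>2) *\<^sub>R U t" if "t \<in> I" for t
  proof -
    have "velocity A t - (2 * ((A t \<bullet> U t) / (U t \<bullet> U t))) *\<^sub>R A t
        + ((A t \<bullet> A t) / (U t \<bullet> U t)) *\<^sub>R U t = 0"
      using sol that
      by (simp add: solves_reduced_iff reduced_vector_def Let_def U_def A_def power2_norm_eq_inner)
    then show ?thesis
      unfolding inv[OF that] by (simp add: eq_diff_eq diff_add_eq diff_eq_eq)
  qed
  define B where "B t = A t - \<alpha> *\<^sub>R U t" for t
  have dU: "(U has_vector_derivative \<alpha> *\<^sub>R U t + B t) (at t)" if "t \<in> I" for t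
    using d(2)[OF that] by (simp add: B_def)
  have dB: "(B has_vector_derivative \<alpha> *\<^sub>R B t - \<beta>\<^sup>2 *\<^sub>R U t) (at t)" if "t \<in> I" for t
  proof -
    have two: "(2 * \<alpha>) *\<^sub>R v = \<alpha> *\<^sub>R v + \<alpha> *\<^sub>R v" for v :: 'a
      by (metis mult_2 scaleR_add_left)
    have "(B has_vector_derivative velocity A t - \<alpha> *\<^sub>R A t) (at t)"
      unfolding B_def[abs_def]
      by (auto intro!: derivative_eq_intros d that)
    also have "velocity A t - \<alpha> *\<^sub>R A t = \<alpha> *\<^sub>R B t - \<beta>\<^sup>2 *\<^sub>R U t"
      unfolding J[OF that] B_def two by (simp add: algebra_simps power2_eq_square)
    finally show ?thesis .
  qed
  have "U t = spiral_velocity \<alpha> \<beta> (U 0) w t" if "t \<in> I" for t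
    using linear_system_unique[OF I that dU dB] by (simp add: B_def a)
  then show ?thesis
    using d(1) by (intro that[OF w]) auto
qed

section \<open>Spiral curves\<close>

lemma has_vector_derivative_spiral_curve:
  "((\<lambda>t. spiral_curve c P Q R (a * t + b)) has_vector_derivative
      a *\<^sub>R (spiral_curve c P Q 0 (a * t + b) + c *\<^sub>R spiral_curve c Q (- P) 0 (a * t + b))) (at t)"
  unfolding spiral_curve_def[abs_def]
  by (rule has_vector_derivative_eq_rhs,
      (rule has_vector_derivative_scaleR has_vector_derivative_add derivative_intros)+)
    (auto intro!: derivative_eq_intros simp: algebra_simps)

lemma spiral_data_spiral_curve:
  assumes "spiral_data P Q"
  shows "spiral_data (spiral_curve c P Q 0 t) (spiral_curve c Q (- P) 0 t)"
  using spiral_data_spiral_velocity[OF assms, of 1 c t]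
  by (simp add: spiral_velocity_def spiral_curve_def)

lemma norm_spiral_curve:
  assumes "spiral_data P Q"
  shows "norm (spiral_curve c P Q 0 t) = exp t * norm P"
  using norm_spiral_velocity[OF assms, of 1 c t]
  by (simp add: spiral_velocity_def spiral_curve_def)

text \<open>The curves \<open>S\<close> and \<open>T\<close> are the spiral about the origin and its quarter turn.  The velocity
  \<open>U = a (S + c T)\<close> and its quarter turn \<open>W = a (T - c S)\<close> form a frame with scaling rate \<open>a\<close> and
  turning rate \<open>a c\<close>.\<close>

lemma solves_reduced_spiral_curve:
  fixes X :: "real \<Rightarrow> 'a::real_inner"
  assumes I: "open I" and PQ: "spiral_data P Q" and a: "a \<noteq> 0"
    and X: "\<And>t. t \<in> I \<Longrightarrow> X t = spiral_curve c P Q R (a * t + b)"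
  shows "solves_reduced I X"
    and "\<And>t. t \<in> I \<Longrightarrow> norm (velocity X t) = \<bar>a\<bar> * sqrt (1 + c\<^sup>2) * norm P * exp (a * t + b)"
proof -
  define S T where "S t = spiral_curve c P Q 0 (a * t + b)"
    and "T t = spiral_curve c Q (- P) 0 (a * t + b)" for t
  have ST: "spiral_data (S t) (T t)" for t
    using spiral_data_spiral_curve[OF PQ] by (simp add: S_def T_def)
  have dS: "(S has_vector_derivative a *\<^sub>R (S t + c *\<^sub>R T t)) (at t)" for t
    using has_vector_derivative_spiral_curve[of c P Q 0 a b] by (simp add: S_def[abs_def] T_def)
  have "spiral_curve c (- P) (- Q) 0 s = - spiral_curve c P Q 0 s" for s
    by (simp add: spiral_curve_def)
  then have dT: "(T has_vector_derivative a *\<^sub>R (T t - c *\<^sub>R S t)) (at t)" for t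
    using has_vector_derivative_spiral_curve[of c Q "- P" 0 a b] by (simp add: S_def T_def[abs_def])
  define U W where "U t = a *\<^sub>R (S t + c *\<^sub>R T t)" and "W t = a *\<^sub>R (T t - c *\<^sub>R S t)" for t
  have dX: "(X has_vector_derivative U t) (at t)" if "t \<in> I" for t
    using has_vector_derivative_transform_within_open
        [OF has_vector_derivative_spiral_curve[of c P Q R a b t] I that] X
    by (simp add: U_def S_def T_def)
  have UW: "U t = a *\<^sub>R S t + (a * c) *\<^sub>R T t" "W t = a *\<^sub>R T t - (a * c) *\<^sub>R S t" for t
    by (simp_all add: U_def W_def algebra_simps)
  show "solves_reduced I X"
  proof (rule solves_reduced_of_rotating_frame[OF I dX])
    show "(U has_vector_derivative a *\<^sub>R U t + (a * c) *\<^sub>R W t) (at t)" for t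
      unfolding U_def[abs_def] W_def
      by (auto intro!: derivative_eq_intros dS dT simp: algebra_simps)
    show "(W has_vector_derivative a *\<^sub>R W t - (a * c) *\<^sub>R U t) (at t)" for t
      unfolding W_def[abs_def] U_def
      by (auto intro!: derivative_eq_intros dS dT simp: algebra_simps)
    show "spiral_data (U t) (W t)" for t
      unfolding UW using a by (intro spiral_data_complex_multiple(2) ST) simp
  qed
  show "norm (velocity X t) = \<bar>a\<bar> * sqrt (1 + c\<^sup>2) * norm P * exp (a * t + b)" if "t \<in> I" for t
  proof -
    have "norm (S t + c *\<^sub>R T t) = sqrt (1 + c\<^sup>2) * norm (S t)"
      using spiral_data_complex_multiple(1)[OF ST, of 1 c t] by simp
    then show ?thesis
      using norm_spiral_curve[OF PQ, of c "a * t + b"]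
      by (simp add: velocity_eqI[OF dX[OF that]] U_def S_def)
  qed
qed

text \<open>Differentiating a spiral multiplies its data by \<open>\<alpha> (1 + i c)\<close> in the identification of
  \<open>(P, Q)\<close> with \<open>(1, i)\<close>, so \<open>P\<close> and \<open>Q\<close> solve \<open>\<alpha> (P + c Q) = u\<close>, \<open>\<alpha> (Q - c P) = w\<close>; this
  system has determinant \<open>\<alpha> m\<close> with \<open>m = \<alpha> (1 + c\<^sup>2) \<noteq> 0\<close>.\<close>

lemma spiral_curve_of_spiral_velocity:
  fixes X :: "real \<Rightarrow> 'a::real_inner"
  assumes I: "connected I" "0 \<in> I" and \<alpha>: "\<alpha> \<noteq> 0" and uw: "spiral_data u w"
    and dX: "\<And>t. t \<in> I \<Longrightarrow> (X has_vector_derivative spiral_velocity \<alpha> \<beta> u w t) (at t)"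
  shows "\<exists>P Q R. spiral_data P Q \<and> (\<forall>t\<in>I. X t = spiral_curve (\<beta> / \<alpha>) P Q R (\<alpha> * t))"
proof -
  define c where "c = \<beta> / \<alpha>"
  define m where "m = \<alpha> * (1 + c\<^sup>2)"
  have m: "m \<noteq> 0" "1 + c\<^sup>2 \<noteq> 0"
    using \<alpha> by (auto simp: m_def add_nonneg_eq_0_iff)
  define P Q where "P = (1 / m) *\<^sub>R u + (- c / m) *\<^sub>R w" and "Q = (1 / m) *\<^sub>R w - (- c / m) *\<^sub>R u"
  have PQ: "spiral_data P Q"
    unfolding P_def Q_def using m by (intro spiral_data_complex_multiple(2) uw) simp
  have "m = \<alpha> + \<alpha> * c * c"
    by (simp add: m_def algebra_simps power2_eq_square)
  then have "\<alpha> / m + \<alpha> * c * c / m = m / m"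
    by (metis add_divide_distrib)
  then have coeff: "\<alpha> / m + \<alpha> * c * c / m = 1"
    using m by simp
  have "\<alpha> *\<^sub>R (P + c *\<^sub>R Q) = (\<alpha> / m + \<alpha> * c * c / m) *\<^sub>R u"
    and "\<alpha> *\<^sub>R (Q - c *\<^sub>R P) = (\<alpha> / m + \<alpha> * c * c / m) *\<^sub>R w"
    by (simp_all add: P_def Q_def algebra_simps)
  then have u: "\<alpha> *\<^sub>R (P + c *\<^sub>R Q) = u" and w: "\<alpha> *\<^sub>R (Q - c *\<^sub>R P) = w"
    unfolding coeff by simp_all
  have \<beta>: "\<beta> = c * \<alpha>"
    using \<alpha> by (simp add: c_def)
  have "\<alpha> *\<^sub>R (spiral_curve c P Q 0 (\<alpha> * t) + c *\<^sub>R spiral_curve c Q (- P) 0 (\<alpha> * t)) =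
      spiral_velocity \<alpha> \<beta> u w t" for t
    unfolding u[symmetric] w[symmetric] \<beta>
    by (simp add: spiral_curve_def spiral_velocity_def algebra_simps)
  then have dS: "((\<lambda>t. spiral_curve c P Q 0 (\<alpha> * t)) has_vector_derivative
      spiral_velocity \<alpha> \<beta> u w t) (at t)" for t
    using has_vector_derivative_spiral_curve[of c P Q 0 \<alpha> 0 t] by simp
  have "((\<lambda>t. X t - spiral_curve c P Q 0 (\<alpha> * t)) has_vector_derivative 0) (at t)" if "t \<in> I" for t
    using has_vector_derivative_diff[OF dX[OF that] dS] by simp
  from zero_derivative_imp_eq[OF I(1) this I(2)]
  have "X t = spiral_curve c P Q (X 0 - spiral_curve c P Q 0 0) (\<alpha> * t)" if "t \<in> I" for t
    using that by (simp add: spiral_curve_def algebra_simps)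
  then show ?thesis
    using PQ unfolding c_def by blast
qed

section \<open>Geometry of the spirals\<close>

lemma spiral_data_plane:
  fixes P Q :: "'a::euclidean_space"
  assumes "spiral_data P Q"
  shows "norm (sgn P) = 1" and "norm (sgn Q) = 1" and "sgn P \<bullet> sgn Q = 0"
    and "span {sgn P, sgn Q} = span {P, Q}" and "dim (span {P, Q}) = 2"
proof -
  have nz: "P \<noteq> 0" "Q \<noteq> 0" "P \<bullet> Q = 0"
    using assms by (auto simp: spiral_data_def)
  show "norm (sgn P) = 1" "norm (sgn Q) = 1"
    using nz by (simp_all add: norm_sgn)
  show "sgn P \<bullet> sgn Q = 0"
    using nz by (simp add: sgn_div_norm)
  have "sgn P \<in> span {P, Q}" "sgn Q \<in> span {P, Q}"
    by (simp_all add: sgn_div_norm span_scale span_base)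
  moreover have "norm P *\<^sub>R sgn P \<in> span {sgn P, sgn Q}" "norm Q *\<^sub>R sgn Q \<in> span {sgn P, sgn Q}"
    by (simp_all add: span_scale span_base)
  then have "P \<in> span {sgn P, sgn Q}" "Q \<in> span {sgn P, sgn Q}"
    using nz by (simp_all add: sgn_div_norm)
  ultimately show "span {sgn P, sgn Q} = span {P, Q}"
    by (simp add: span_eq)
  have "P \<noteq> Q"
    using nz by auto
  moreover have "independent {P, Q}"
    using nz by (intro pairwise_orthogonal_independent)
      (auto simp: pairwise_def orthogonal_def inner_commute)
  ultimately show "dim (span {P, Q}) = 2"
    using dim_span_eq_card_independent[of "{P, Q}"] by simp
qed

lemma spiral_curve_eq_polar_point:
  assumes "spiral_data P Q"
  shows "spiral_curve c P Q R t = polar_point R (sgn P) (sgn Q) (norm P * exp t) (c * t)"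
proof -
  have PQ: "norm P = norm Q" "P \<noteq> 0" "Q \<noteq> 0"
    using assms by (auto simp: spiral_data_def)
  have "polar_point R (sgn P) (sgn Q) (norm P * exp t) (c * t) =
      (exp t * cos (c * t)) *\<^sub>R norm P *\<^sub>R sgn P + (exp t * sin (c * t)) *\<^sub>R norm Q *\<^sub>R sgn Q + R"
    by (simp add: polar_point_def PQ(1) mult_ac add_ac)
  also have "\<dots> = spiral_curve c P Q R t"
    using PQ(2,3) by (simp add: spiral_curve_def sgn_div_norm)
  finally show ?thesis by simp
qed

lemma range_spiral_curve:
  assumes "spiral_data P Q" and "c \<noteq> 0"
  shows "range (spiral_curve c P Q R) =
    {polar_point R (sgn P) (sgn Q) r \<theta> | r \<theta>. r = norm P * exp (\<theta> / c)}"
proof (intro set_eqI iffI)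
  fix x assume "x \<in> range (spiral_curve c P Q R)"
  then obtain t where "x = polar_point R (sgn P) (sgn Q) (norm P * exp t) (c * t)"
    using spiral_curve_eq_polar_point[OF assms(1)] by auto
  then have "x = polar_point R (sgn P) (sgn Q) (norm P * exp (c * t / c)) (c * t)"
    using assms(2) by simp
  then show "x \<in> {polar_point R (sgn P) (sgn Q) r \<theta> | r \<theta>. r = norm P * exp (\<theta> / c)}"
    by blast
next
  fix x assume "x \<in> {polar_point R (sgn P) (sgn Q) r \<theta> | r \<theta>. r = norm P * exp (\<theta> / c)}"
  then obtain \<theta> where "x = polar_point R (sgn P) (sgn Q) (norm P * exp (\<theta> / c)) \<theta>"
    by auto
  then have "x = spiral_curve c P Q R (\<theta> / c)"
    using assms(2) by (simp add: spiral_curve_eq_polar_point[OF assms(1)])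
  then show "x \<in> range (spiral_curve c P Q R)"
    by simp
qed

lemma spiral_curve_tendsto:
  assumes "spiral_data P Q"
  shows "(spiral_curve c P Q R \<longlongrightarrow> R) at_bot"
proof -
  have "((\<lambda>t. exp t * norm P) \<longlongrightarrow> 0 * norm P) at_bot"
    by (intro tendsto_mult exp_at_bot tendsto_const)
  then have "((\<lambda>t. norm (spiral_curve c P Q 0 t)) \<longlongrightarrow> 0) at_bot"
    by (simp add: norm_spiral_curve[OF assms])
  then have "((\<lambda>t. spiral_curve c P Q 0 t + R) \<longlongrightarrow> 0 + R) at_bot"
    by (intro tendsto_add tendsto_const) (rule tendsto_norm_zero_cancel)
  then show ?thesis
    by (simp add: spiral_curve_def[abs_def])
qed

lemma spirals_towards_spiral_curve:
  fixes P Q :: "'a::euclidean_space"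
  assumes PQ: "spiral_data P Q" and c: "c \<noteq> 0"
  shows "spirals_towards (span {P, Q}) R (spiral_curve c P Q R) at_bot"
proof -
  have "((\<lambda>t. norm P * exp t) \<longlongrightarrow> norm P * 0) at_bot"
    by (intro tendsto_mult exp_at_bot tendsto_const)
  moreover have "filterlim (\<lambda>t. \<bar>c * t\<bar>) at_top at_bot"
  proof -
    have "filterlim (\<lambda>t::real. \<bar>t\<bar>) at_top at_bot"
      by (simp add: filterlim_at_bot_mirror filterlim_abs_real)
    then have "filterlim (\<lambda>t. \<bar>c\<bar> * \<bar>t\<bar>) at_top at_bot"
      using c by (intro filterlim_tendsto_pos_mult_at_top[OF tendsto_const]) auto
    then show ?thesis
      by (simp add: abs_mult)
  qed
  moreover have "continuous_on UNIV (\<lambda>t. c * t)"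
    by (intro continuous_intros)
  moreover have "P \<noteq> 0"
    using PQ by (simp add: spiral_data_def)
  ultimately show ?thesis
    unfolding spirals_towards_def
    using spiral_data_plane[OF PQ] spiral_curve_eq_polar_point[OF PQ, of c R]
    by - (rule exI[of _ "sgn P"], rule exI[of _ "sgn Q"],
        rule exI[of _ "\<lambda>t. norm P * exp t"], rule exI[of _ "\<lambda>t. c * t"], simp)
qed

lemma logarithmic_spiral_spiral_curve:
  fixes P Q :: "'a::euclidean_space"
  assumes PQ: "spiral_data P Q" and c: "c \<noteq> 0"
  shows "logarithmic_spiral (span {P, Q}) R (range (spiral_curve c P Q R))"
proof -
  have "P \<noteq> 0"
    using PQ by (simp add: spiral_data_def)
  then have "norm P > 0"
    by simp
  then show ?thesis
    unfolding logarithmic_spiral_def range_spiral_curve[OF assms]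
    using spiral_data_plane[OF PQ] c
    by - (rule exI[of _ "sgn P"], rule exI[of _ "sgn Q"], rule exI[of _ "norm P"],
      rule exI[of _ "1 / c"], simp)
qed

section \<open>The general solution\<close>

lemma open_contains_nonzero:
  fixes I :: "real set"
  assumes "open I" and "0 \<in> I"
  obtains s where "s \<in> I" and "s \<noteq> 0"
proof -
  obtain e where "e > 0" "ball 0 e \<subseteq> I"
    using assms open_contains_ball by blast
  then show ?thesis
    by (intro that[of "e / 2"]) auto
qed

text \<open>Since \<open>I\<close> is open it contains a time other than \<open>0\<close>, and comparing the speeds
  \<open>K e\<^sup>t\<close> and \<open>e\<^sup>\<alpha>\<^sup>t |u|\<close> at these two times forces \<open>\<alpha> = 1\<close>.\<close>

lemma reduced_exponential_speed_iff_spiral: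
  fixes X :: "real \<Rightarrow> 'a::euclidean_space"
  assumes dim: "2 \<le> DIM('a)" and I: "open I" "connected I" "0 \<in> I"
  shows "solves_reduced I X \<and> (\<exists>K. \<forall>t\<in>I. norm (velocity X t) = K * exp t) \<longleftrightarrow>
    (\<exists>c P Q R. spiral_data P Q \<and> (\<forall>t\<in>I. X t = spiral_curve c P Q R t))"
proof
  assume *: "solves_reduced I X \<and> (\<exists>K. \<forall>t\<in>I. norm (velocity X t) = K * exp t)"
  then obtain K where K: "\<And>t. t \<in> I \<Longrightarrow> norm (velocity X t) = K * exp t"
    by auto
  obtain \<alpha> \<beta> u w where uw: "spiral_data u w"
    and dX: "\<And>t. t \<in> I \<Longrightarrow> (X has_vector_derivative spiral_velocity \<alpha> \<beta> u w t) (at t)"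
    by (rule solves_reduced_imp_spiral_velocity[OF dim I(2,3) conjunct1[OF *]]) (rule that)
  have speed: "K * exp t = exp (\<alpha> * t) * norm u" if "t \<in> I" for t
    using K[OF that] by (simp add: velocity_eqI[OF dX[OF that]] norm_spiral_velocity[OF uw])
  obtain s where s: "s \<in> I" "s \<noteq> 0"
    using open_contains_nonzero[OF I(1,3)] .
  have "K = norm u" "norm u \<noteq> 0"
    using speed[OF I(3)] uw unfolding spiral_data_def by (simp, metis norm_eq_zero)
  then have \<alpha>: "\<alpha> = 1" "\<alpha> \<noteq> 0"
    using speed[OF s(1)] s(2) by simp_all
  obtain P Q R where "spiral_data P Q" "\<And>t. t \<in> I \<Longrightarrow> X t = spiral_curve (\<beta> / \<alpha>) P Q R (\<alpha> * t)"
    using spiral_curve_of_spiral_velocity[OF I(2,3) \<alpha>(2) uw dX] by metis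
  then show "\<exists>c P Q R. spiral_data P Q \<and> (\<forall>t\<in>I. X t = spiral_curve c P Q R t)"
    using \<alpha> by auto
next
  assume "\<exists>c P Q R. spiral_data P Q \<and> (\<forall>t\<in>I. X t = spiral_curve c P Q R t)"
  then obtain c P Q R where "spiral_data P Q"
    and "\<And>t. t \<in> I \<Longrightarrow> X t = spiral_curve c P Q R (1 * t + 0)"
    by auto
  from solves_reduced_spiral_curve[OF I(1) this(1) _ this(2)]
  show "solves_reduced I X \<and> (\<exists>K. \<forall>t\<in>I. norm (velocity X t) = K * exp t)"
    by auto
qed

text \<open>An affine change of the parameter replaces the normalisation \<open>\<alpha> = 1\<close> by \<open>\<alpha> \<noteq> 0\<close>, and
  \<open>\<alpha> \<noteq> 0\<close> is the same as nonconstant speed.\<close>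

lemma reduced_nonconstant_speed_iff_spiral:
  fixes X :: "real \<Rightarrow> 'a::euclidean_space"
  assumes dim: "2 \<le> DIM('a)" and I: "open I" "connected I" "0 \<in> I"
  shows "solves_reduced I X \<and> \<not> (\<lambda>t. norm (velocity X t)) constant_on I \<longleftrightarrow>
    (\<exists>a b c P Q R. a \<noteq> 0 \<and> spiral_data P Q \<and> (\<forall>t\<in>I. X t = spiral_curve c P Q R (a * t + b)))"
proof
  assume *: "solves_reduced I X \<and> \<not> (\<lambda>t. norm (velocity X t)) constant_on I"
  obtain \<alpha> \<beta> u w where uw: "spiral_data u w"
    and dX: "\<And>t. t \<in> I \<Longrightarrow> (X has_vector_derivative spiral_velocity \<alpha> \<beta> u w t) (at t)"
    by (rule solves_reduced_imp_spiral_velocity[OF dim I(2,3) conjunct1[OF *]]) (rule that)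
  have speed: "norm (velocity X t) = exp (\<alpha> * t) * norm u" if "t \<in> I" for t
    by (simp add: velocity_eqI[OF dX[OF that]] norm_spiral_velocity[OF uw])
  have \<alpha>: "\<alpha> \<noteq> 0"
    using * speed by (auto simp: constant_on_def)
  obtain P Q R where "spiral_data P Q" "\<And>t. t \<in> I \<Longrightarrow> X t = spiral_curve (\<beta> / \<alpha>) P Q R (\<alpha> * t)"
    using spiral_curve_of_spiral_velocity[OF I(2,3) \<alpha> uw dX] by metis
  then show "\<exists>a b c P Q R. a \<noteq> 0 \<and> spiral_data P Q \<and> (\<forall>t\<in>I. X t = spiral_curve c P Q R (a * t + b))"
    using \<alpha> by (metis add.right_neutral)
next
  assume "\<exists>a b c P Q R. a \<noteq> 0 \<and> spiral_data P Q \<and> (\<forall>t\<in>I. X t = spiral_curve c P Q R (a * t + b))"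
  then obtain a b c P Q R where a: "a \<noteq> 0" and PQ: "spiral_data P Q"
    and X: "\<And>t. t \<in> I \<Longrightarrow> X t = spiral_curve c P Q R (a * t + b)"
    by auto
  have sol: "solves_reduced I X"
    by (rule solves_reduced_spiral_curve(1)[OF I(1) PQ a X])
  have speed: "norm (velocity X t) = \<bar>a\<bar> * sqrt (1 + c\<^sup>2) * norm P * exp (a * t + b)" if "t \<in> I" for t
    by (rule solves_reduced_spiral_curve(2)[OF I(1) PQ a X that])
  obtain s where s: "s \<in> I" "s \<noteq> 0"
    using open_contains_nonzero[OF I(1,3)] .
  have "\<bar>a\<bar> * sqrt (1 + c\<^sup>2) * norm P \<noteq> 0"
    using a PQ by (auto simp: spiral_data_def add_nonneg_eq_0_iff)
  then have "norm (velocity X s) \<noteq> norm (velocity X 0)"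
    unfolding speed[OF s(1)] speed[OF I(3)] using a s(2) by simp
  then show "solves_reduced I X \<and> \<not> (\<lambda>t. norm (velocity X t)) constant_on I"
    using sol s(1) I(3) unfolding constant_on_def by metis
qed

theorem mainTheorem3:
  fixes I :: "real set" and X :: "real \<Rightarrow> real ^ 'n"
  assumes "CARD('n) \<ge> 2" and "open I" and "connected I" and "0 \<in> I"
  shows
    "(solves_mercator I X \<and> mercator_vector X 0 = 0 \<longleftrightarrow> solves_reduced I X) \<and>
     (\<forall>x0 u0 a0 :: real ^ 'n. u0 \<noteq> 0 \<longrightarrow>
        (\<exists>Y. solves_mercator UNIV Y \<and> mercator_vector Y 0 = 0 \<and>
             Y 0 = x0 \<and> velocity Y 0 = u0 \<and> acceleration Y 0 = a0)) \<and>
     (solves_reduced I X \<and> (\<exists>K. \<forall>t\<in>I. norm (velocity X t) = K * exp t) \<longleftrightarrow>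
        (\<exists>c P\<^sub>0 Q\<^sub>0 R\<^sub>0. spiral_data P\<^sub>0 Q\<^sub>0 \<and> (\<forall>t\<in>I. X t = spiral_curve c P\<^sub>0 Q\<^sub>0 R\<^sub>0 t))) \<and>
     (solves_reduced I X \<and> \<not> (\<lambda>t. norm (velocity X t)) constant_on I \<longleftrightarrow>
        (\<exists>a b c P\<^sub>0 Q\<^sub>0 R\<^sub>0. a \<noteq> 0 \<and> spiral_data P\<^sub>0 Q\<^sub>0 \<and>
           (\<forall>t\<in>I. X t = spiral_curve c P\<^sub>0 Q\<^sub>0 R\<^sub>0 (a * t + b)))) \<and>
     (\<forall>c (P\<^sub>0 :: real ^ 'n) Q\<^sub>0 R\<^sub>0. spiral_data P\<^sub>0 Q\<^sub>0 \<longrightarrow>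
        dim (span {P\<^sub>0, Q\<^sub>0}) = 2 \<and>
        (\<forall>t. spiral_curve c P\<^sub>0 Q\<^sub>0 R\<^sub>0 t - R\<^sub>0 \<in> span {P\<^sub>0, Q\<^sub>0}) \<and>
        (spiral_curve c P\<^sub>0 Q\<^sub>0 R\<^sub>0 \<longlongrightarrow> R\<^sub>0) at_bot \<and>
        (c \<noteq> 0 \<longrightarrow>
           logarithmic_spiral (span {P\<^sub>0, Q\<^sub>0}) R\<^sub>0 (range (spiral_curve c P\<^sub>0 Q\<^sub>0 R\<^sub>0)) \<and>
           spirals_towards (span {P\<^sub>0, Q\<^sub>0}) R\<^sub>0 (spiral_curve c P\<^sub>0 Q\<^sub>0 R\<^sub>0) at_bot \<and>
           range (spiral_curve c P\<^sub>0 Q\<^sub>0 R\<^sub>0) =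
             {polar_point R\<^sub>0 (sgn P\<^sub>0) (sgn Q\<^sub>0) r \<theta> | r \<theta>. r = norm P\<^sub>0 * exp (\<theta> / c)}))"
proof (intro conjI)
  have dim: "2 \<le> DIM(real ^ 'n)"
    using assms(1) by simp
  show "solves_mercator I X \<and> mercator_vector X 0 = 0 \<longleftrightarrow> solves_reduced I X"
    using solves_mercator_zero_iff_solves_reduced[OF assms(2-4)] .
  show "\<forall>x0 u0 a0 :: real ^ 'n. u0 \<noteq> 0 \<longrightarrow>
      (\<exists>Y. solves_mercator UNIV Y \<and> mercator_vector Y 0 = 0 \<and>
           Y 0 = x0 \<and> velocity Y 0 = u0 \<and> acceleration Y 0 = a0)"
  proof (intro allI impI)
    fix x0 u0 a0 :: "real ^ 'n"
    assume "u0 \<noteq> 0"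
    then obtain Y where "solves_reduced UNIV Y" "Y 0 = x0" "velocity Y 0 = u0" "acceleration Y 0 = a0"
      using exists_reduced_solution[OF dim] by blast
    moreover from this have "solves_mercator UNIV Y \<and> mercator_vector Y 0 = 0"
      by (simp add: solves_mercator_zero_iff_solves_reduced)
    ultimately show "\<exists>Y. solves_mercator UNIV Y \<and> mercator_vector Y 0 = 0 \<and>
        Y 0 = x0 \<and> velocity Y 0 = u0 \<and> acceleration Y 0 = a0"
      by blast
  qed
  show "solves_reduced I X \<and> (\<exists>K. \<forall>t\<in>I. norm (velocity X t) = K * exp t) \<longleftrightarrow>
      (\<exists>c P\<^sub>0 Q\<^sub>0 R\<^sub>0. spiral_data P\<^sub>0 Q\<^sub>0 \<and> (\<forall>t\<in>I. X t = spiral_curve c P\<^sub>0 Q\<^sub>0 R\<^sub>0 t))"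
    using reduced_exponential_speed_iff_spiral[OF dim assms(2-4)] .
  show "solves_reduced I X \<and> \<not> (\<lambda>t. norm (velocity X t)) constant_on I \<longleftrightarrow>
      (\<exists>a b c P\<^sub>0 Q\<^sub>0 R\<^sub>0. a \<noteq> 0 \<and> spiral_data P\<^sub>0 Q\<^sub>0 \<and>
         (\<forall>t\<in>I. X t = spiral_curve c P\<^sub>0 Q\<^sub>0 R\<^sub>0 (a * t + b)))"
    using reduced_nonconstant_speed_iff_spiral[OF dim assms(2-4)] .
next
  have plane: "spiral_curve c P Q R t - R \<in> span {P, Q}" for c t and P Q R :: "real ^ 'n"
    by (simp add: spiral_curve_def span_add span_scale span_base)
  show "\<forall>c (P\<^sub>0 :: real ^ 'n) Q\<^sub>0 R\<^sub>0. spiral_data P\<^sub>0 Q\<^sub>0 \<longrightarrow>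
        dim (span {P\<^sub>0, Q\<^sub>0}) = 2 \<and>
        (\<forall>t. spiral_curve c P\<^sub>0 Q\<^sub>0 R\<^sub>0 t - R\<^sub>0 \<in> span {P\<^sub>0, Q\<^sub>0}) \<and>
        (spiral_curve c P\<^sub>0 Q\<^sub>0 R\<^sub>0 \<longlongrightarrow> R\<^sub>0) at_bot \<and>
        (c \<noteq> 0 \<longrightarrow>
           logarithmic_spiral (span {P\<^sub>0, Q\<^sub>0}) R\<^sub>0 (range (spiral_curve c P\<^sub>0 Q\<^sub>0 R\<^sub>0)) \<and>
           spirals_towards (span {P\<^sub>0, Q\<^sub>0}) R\<^sub>0 (spiral_curve c P\<^sub>0 Q\<^sub>0 R\<^sub>0) at_bot \<and>
           range (spiral_curve c P\<^sub>0 Q\<^sub>0 R\<^sub>0) =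
             {polar_point R\<^sub>0 (sgn P\<^sub>0) (sgn Q\<^sub>0) r \<theta> | r \<theta>. r = norm P\<^sub>0 * exp (\<theta> / c)})"
    by (intro allI impI conjI spiral_data_plane(5) plane spiral_curve_tendsto
        logarithmic_spiral_spiral_curve spirals_towards_spiral_curve range_spiral_curve)
qed

end
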